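(* Let $f_2:[0,1]\to[0,1]$ be the 2-tent map, $f_2(x)=2x$ if $0\le x<\frac12$ and $f_2(x)=2(1-x)$ if $\frac12\le x\le1$, and let $d(x,y)=|x-y|$ be the Euclidean metric on $[0,1]$. Then the discrete dynamical system $([0,1],d,f_2)$ is chaotic.
   Context: A discrete dynamical system $(X,d,f)$ consists of a set $X$, a metric $d$ on $X$, and a function $f:X\to X$. It is topologically transitive if and only if for every pair of nonempty open sets $U,V$ of $(X,d)$ there is an integer $n\ge 0$ with $f^n(U)\cap V\ne\emptyset$. It is sensitive if and only if there is a real $\epsilon>0$ such that for every $x\in X$ and every $\delta>0$ there exist $y\in X$ and a positive integer $n$ with $d(x,y)<\delta$ and $d(f^n(x),f^n(y))>\epsilon$. It has dense periodic orbits if and only if every nonempty open set $U$ of $(X,d)$ contains an element $x$ with $f^n(x)=x$ for some positive integer $n$. It is chaotic (Devaney chaotic) if and only if it is topologically transitive, sensitive, and has dense periodic orbits. *)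

theory Defs
  imports "HOL-Analysis.Analysis"
begin

locale discrete_dynamical_system = Metric_space X d
  for X :: "'a set" and d :: "'a \<Rightarrow> 'a \<Rightarrow> real" +
  fixes f :: "'a \<Rightarrow> 'a"
  assumes self_map: "f \<in> X \<rightarrow> X"
begin

definition topologically_transitive :: bool where
  "topologically_transitive \<longleftrightarrow>
     (\<forall>U V. openin mtopology U \<and> U \<noteq> {} \<and> openin mtopology V \<and> V \<noteq> {} \<longrightarrow>
        (\<exists>n::nat. (f ^^ n) ` U \<inter> V \<noteq> {}))"

definition sensitive :: bool where
  "sensitive \<longleftrightarrow>
     (\<exists>\<epsilon>>0. \<forall>x\<in>X. \<forall>\<delta>>0. \<exists>y\<in>X. \<exists>n::nat. n > 0 \<and>
        d x y < \<delta> \<and> d ((f ^^ n) x) ((f ^^ n) y) > \<epsilon>)"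

definition dense_periodic_orbits :: bool where
  "dense_periodic_orbits \<longleftrightarrow>
     (\<forall>U. openin mtopology U \<and> U \<noteq> {} \<longrightarrow> (\<exists>x\<in>U. \<exists>n::nat. n > 0 \<and> (f ^^ n) x = x))"

definition chaotic :: bool where
  "chaotic \<longleftrightarrow> topologically_transitive \<and> sensitive \<and> dense_periodic_orbits"

end

text \<open>The formula is extended to all reals, but only the values on \<open>{0..1}\<close> matter.\<close>

definition tent2 :: "real \<Rightarrow> real" where
  "tent2 x = (if x < 1/2 then 2 * x else 2 * (1 - x))"

end

(* On each dyadic interval of length 1 / 2 ^ n the n-th iterate of the tent map is affine and
   maps the interval onto [0, 1]. Every neighbourhood of a point contains such an interval, so it
   contains a preimage of any prescribed value (transitivity, and sensitivity by choosing the value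
   0 or 1) and a fixed point of the iterate (dense periodic orbits). *)
theory Submission
  imports Defs
begin

lemma tent2_mapsto: "tent2 \<in> {0..1} \<rightarrow> {0..1}"
  by (auto simp: tent2_def)

lemma tent2_funpow_mem: "x \<in> {0..1} \<Longrightarrow> (tent2 ^^ n) x \<in> {0..1}"
  using tent2_mapsto by (induction n) auto

lemma tent2_reflect: "tent2 (1 - x) = tent2 x"
  by (auto simp: tent2_def)

text \<open>The induction splits off the outermost application of \<open>tent2\<close>. Interval
  \<open>k\<close> of level \<open>Suc n\<close> is the left or right half of interval
  \<open>k div 2\<close> of level \<open>n\<close>, and \<open>s\<close> is the position inside the
  latter. Its orientation there does not matter, because \<open>tent2\<close> is symmetric about
  1/2, so only the parity of \<open>k\<close> survives.\<close>

lemma tent2_funpow_dyadic: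
  fixes t :: real
  assumes "k < 2 ^ n" "t \<in> {0..1}"
  shows "(tent2 ^^ n) ((real k + t) / 2 ^ n) = (if even k then t else 1 - t)"
  using assms
proof (induction n arbitrary: k t)
  case 0
  then show ?case by simp
next
  case (Suc n)
  define j where "j = k div 2"
  define s where "s = (if even k then t / 2 else (1 + t) / 2)"
  have k: "real k = 2 * real j + (if even k then 0 else 1)"
    unfolding j_def by (auto elim!: evenE oddE)
  have "(real k + t) / 2 ^ Suc n = (real j + s) / 2 ^ n"
    unfolding k s_def by (auto simp: field_simps)
  moreover have "j < 2 ^ n" and "s \<in> {0..1}"
    using Suc.prems by (auto simp: j_def s_def)
  ultimately have "(tent2 ^^ Suc n) ((real k + t) / 2 ^ Suc n) = tent2 (if even j then s else 1 - s)"
    using Suc.IH[of j s] by simp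
  also have "\<dots> = tent2 s"
    by (simp add: tent2_reflect)
  also have "\<dots> = (if even k then t else 1 - t)"
    using Suc.prems by (auto simp: s_def tent2_def field_simps)
  finally show ?case .
qed

lemma dyadic_interval_near:
  fixes x \<delta> :: real
  assumes "x \<in> {0..1}" "\<delta> > 0"
  obtains n k :: nat where "n > 0" "k < 2 ^ n"
    "\<And>t. t \<in> {0..1} \<Longrightarrow> (real k + t) / 2 ^ n \<in> {0..1}"
    "\<And>t. t \<in> {0..1} \<Longrightarrow> \<bar>x - (real k + t) / 2 ^ n\<bar> < \<delta>"
proof -
  obtain m where m: "(1 / 2) ^ m < \<delta>"
    using real_arch_pow_inv[of \<delta> "1/2"] assms by auto
  \<comment> \<open>The successor guarantees \<open>n > 0\<close> even when a large \<delta> allows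
    \<open>m = 0\<close>.\<close>
  define n where "n = Suc m"
  have "(1 / 2) ^ n \<le> (1 / 2 :: real) ^ m"
    by (simp add: n_def)
  then have n: "n > 0" "1 < \<delta> * 2 ^ n"
    using m by (auto simp: n_def field_simps)
  obtain k :: nat where k: "k < 2 ^ n" "real k \<le> x * 2 ^ n" "x * 2 ^ n \<le> real k + 1"
  \<comment> \<open>At \<open>x = 1\<close> the floor would give \<open>2 ^ n\<close>, one past the
    last interval, so the last interval is taken instead.\<close>
  proof (cases "x = 1")
    case True
    then show ?thesis
      using that[of "2 ^ n - 1"] by (simp add: of_nat_diff)
  next
    case False
    define k where "k = nat \<lfloor>x * 2 ^ n\<rfloor>"
    have k: "real k \<le> x * 2 ^ n" "x * 2 ^ n \<le> real k + 1"
      using assms by (auto simp: k_def)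
    have "x * 2 ^ n < 1 * 2 ^ n"
      using False assms by (intro mult_strict_right_mono) auto
    then have "real k < 2 ^ n"
      using k by linarith
    then show ?thesis
      using k that[of k] by simp
  qed
  show ?thesis
  proof (rule that[OF n(1) k(1)])
    fix t :: real assume t: "t \<in> {0..1}"
    have "real (Suc k) \<le> real (2 ^ n)"
      using k(1) by (simp only: of_nat_le_iff Suc_le_eq)
    then show "(real k + t) / 2 ^ n \<in> {0..1}"
      using t by (auto simp: field_simps)
    \<comment> \<open>Both numbers lie in [k, k + 1], so they differ by at most 1.\<close>
    have "\<bar>x * 2 ^ n - (real k + t)\<bar> < \<delta> * 2 ^ n"
      using k n t by auto
    moreover have "x - (real k + t) / 2 ^ n = (x * 2 ^ n - (real k + t)) / 2 ^ n"
      by (simp add: field_simps)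
    ultimately show "\<bar>x - (real k + t) / 2 ^ n\<bar> < \<delta>"
      by (simp add: pos_divide_less_eq)
  qed
qed

text \<open>The time \<open>n\<close> is fixed before the target \<open>z\<close>, so that
  sensitivity can choose \<open>z\<close> according to where the \<open>n\<close>-th iterate sends
  \<open>x\<close>.\<close>

lemma tent2_funpow_onto_near:
  assumes "x \<in> {0..1}" "\<delta> > 0"
  obtains n where "n > 0"
    "\<And>z. z \<in> {0..1} \<Longrightarrow> \<exists>y\<in>{0..1}. \<bar>x - y\<bar> < \<delta> \<and> (tent2 ^^ n) y = z"
proof -
  obtain n k :: nat where nk: "n > 0" "k < 2 ^ n"
    "\<And>t. t \<in> {0..1} \<Longrightarrow> (real k + t) / 2 ^ n \<in> {0..1}"
    "\<And>t. t \<in> {0..1} \<Longrightarrow> \<bar>x - (real k + t) / 2 ^ n\<bar> < \<delta>"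
    using dyadic_interval_near[OF assms] by metis
  have "\<exists>y\<in>{0..1}. \<bar>x - y\<bar> < \<delta> \<and> (tent2 ^^ n) y = z" if "z \<in> {0..1}" for z
  proof -
    \<comment> \<open>The affine map on interval \<open>k\<close> is either the identity or the flip
      in the coordinate \<open>t\<close>; both are their own inverses.\<close>
    define t where "t = (if even k then z else 1 - z)"
    have t: "t \<in> {0..1}"
      using that by (auto simp: t_def)
    have "(tent2 ^^ n) ((real k + t) / 2 ^ n) = z"
      using tent2_funpow_dyadic[OF nk(2) t] by (simp add: t_def)
    then show ?thesis
      using nk(3,4)[OF t] by blast
  qed
  with nk(1) show ?thesis
    using that by blast
qed

lemma tent2_periodic_near:
  assumes "x \<in> {0..1}" "\<delta> > 0"
  obtains n y where "n > 0" "y \<in> {0..1}" "\<bar>x - y\<bar> < \<delta>" "(tent2 ^^ n) y = y"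
proof -
  obtain n k :: nat where nk: "n > 0" "k < 2 ^ n"
    "\<And>t. t \<in> {0..1} \<Longrightarrow> (real k + t) / 2 ^ n \<in> {0..1}"
    "\<And>t. t \<in> {0..1} \<Longrightarrow> \<bar>x - (real k + t) / 2 ^ n\<bar> < \<delta>"
    using dyadic_interval_near[OF assms] by metis
  (* The solution of (k + t) / 2 ^ n = t for even k, and of (k + t) / 2 ^ n = 1 - t for odd k. *)
  define t where "t = (if even k then real k / (2 ^ n - 1) else (2 ^ n - real k) / (2 ^ n + 1))"
  \<comment> \<open>This keeps the denominator \<open>2 ^ n - 1\<close> positive; it fails for
    \<open>n = 0\<close>.\<close>
  have pow: "(2::real) ^ n > 1"
    using nk(1) by simp
  have "real (Suc k) \<le> real (2 ^ n)"
    using nk(2) by (simp only: of_nat_le_iff Suc_le_eq)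
  then have k: "real k + 1 \<le> 2 ^ n"
    by simp
  have t: "t \<in> {0..1}"
    using k pow nk(2) by (auto simp: t_def divide_simps)
  have "(real k + t) / 2 ^ n = (if even k then t else 1 - t)"
    using pow by (auto simp: t_def divide_simps) (auto simp: algebra_simps)
  then have "(tent2 ^^ n) ((real k + t) / 2 ^ n) = (real k + t) / 2 ^ n"
    using tent2_funpow_dyadic[OF nk(2) t] by simp
  then show ?thesis
    using nk(1) nk(3,4)[OF t] that by blast
qed

lemma tent2_discrete_dynamical_system:
  "discrete_dynamical_system {0..1::real} (\<lambda>x y. \<bar>x - y\<bar>) tent2"
  using tent2_mapsto by unfold_locales auto

theorem mainTheorem10:
  shows "discrete_dynamical_system {0..1::real} (\<lambda>x y. \<bar>x - y\<bar>) tent2 \<and>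
         discrete_dynamical_system.chaotic {0..1::real} (\<lambda>x y. \<bar>x - y\<bar>) tent2"
proof
  show "discrete_dynamical_system {0..1::real} (\<lambda>x y. \<bar>x - y\<bar>) tent2"
    by (rule tent2_discrete_dynamical_system)
  interpret discrete_dynamical_system "{0..1::real}" "\<lambda>x y. \<bar>x - y\<bar>" tent2
    by (rule tent2_discrete_dynamical_system)
  \<comment> \<open>Translates openness in the metric topology of [0, 1] into the form of the
    preceding approximation lemmas.\<close>
  have openD: "\<exists>x\<in>{0..1}. \<exists>\<delta>>0. \<forall>y\<in>{0..1}. \<bar>x - y\<bar> < \<delta> \<longrightarrow> y \<in> U"
    if U: "openin mtopology U" "U \<noteq> {}" for U
  proof -
    obtain x where "x \<in> U"
      using U by blast
    then obtain \<delta> where "\<delta> > 0" "mball x \<delta> \<subseteq> U" "x \<in> {0..1}"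
      using U unfolding openin_mtopology by blast
    then show ?thesis
      by (intro bexI[of _ x] exI[of _ \<delta>]) (auto simp: mball_def)
  qed
  have "topologically_transitive"
    unfolding topologically_transitive_def
  proof (intro allI impI, elim conjE)
    fix U V assume U: "openin mtopology U" "U \<noteq> {}" and V: "openin mtopology V" "V \<noteq> {}"
    obtain x \<delta> where x: "x \<in> {0..1}" "\<delta> > 0" "\<And>y. y \<in> {0..1} \<Longrightarrow> \<bar>x - y\<bar> < \<delta> \<Longrightarrow> y \<in> U"
      using openD[OF U] by blast
    obtain v where "v \<in> V" "v \<in> {0..1}"
      using V unfolding openin_mtopology by blast
    then show "\<exists>n. (tent2 ^^ n) ` U \<inter> V \<noteq> {}"
      using tent2_funpow_onto_near[OF x(1,2)] x(3) by (metis IntI emptyE imageI)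
  qed
  moreover have "sensitive"
    unfolding sensitive_def
  \<comment> \<open>Each point of [0, 1] is at distance at least 1/2 from 0 or from 1, so any
    positive constant below 1/2 would serve; \<open>z\<close> below is such a far endpoint.\<close>
  proof (intro exI[of _ "1/4"] conjI ballI allI impI)
    fix x \<delta> :: real assume x: "x \<in> {0..1}" "\<delta> > 0"
    obtain n where n: "n > 0"
      "\<And>z. z \<in> {0..1} \<Longrightarrow> \<exists>y\<in>{0..1}. \<bar>x - y\<bar> < \<delta> \<and> (tent2 ^^ n) y = z"
      using tent2_funpow_onto_near[OF x] by metis
    define z :: real where "z = (if (tent2 ^^ n) x < 1/2 then 1 else 0)"
    have "z \<in> {0..1}" "\<bar>(tent2 ^^ n) x - z\<bar> > 1/4"
      using tent2_funpow_mem[OF x(1), of n] by (auto simp: z_def)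
    then show "\<exists>y\<in>{0..1}. \<exists>n>0. \<bar>x - y\<bar> < \<delta> \<and> 1/4 < \<bar>(tent2 ^^ n) x - (tent2 ^^ n) y\<bar>"
      using n by metis
  qed simp
  moreover have "dense_periodic_orbits"
    unfolding dense_periodic_orbits_def
  proof (intro allI impI, elim conjE)
    fix U assume U: "openin mtopology U" "U \<noteq> {}"
    obtain x \<delta> where x: "x \<in> {0..1}" "\<delta> > 0" "\<And>y. y \<in> {0..1} \<Longrightarrow> \<bar>x - y\<bar> < \<delta> \<Longrightarrow> y \<in> U"
      using openD[OF U] by blast
    show "\<exists>x\<in>U. \<exists>n>0. (tent2 ^^ n) x = x"
      using tent2_periodic_near[OF x(1,2)] x(3) by metis
  qed
  ultimately show "chaotic"
    by (simp add: chaotic_def)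
qed

end
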